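(* For any integer $a\geq 2$, there exists a graph $G$ with $\mathrm{diam}(G)=2$ such that $L_2(G)=a$.
   Context: All graphs are finite, undirected and simple. $\mathrm{diam}(G)$ is the diameter and $N[v]=\{v\}\cup N(v)$ is the closed neighbourhood of $v$. A set $B\subseteq V(G)$ is a $2$-limited packing if $|N[v]\cap B|\le 2$ for every vertex $v$ of $G$; $L_2(G)$ is the maximum cardinality of a $2$-limited packing in $G$. *)

theory Defs
  imports "Graph_Theory.Pair_Digraph" "Graph_Theory.Shortest_Path"
begin

text \<open>
  A finite simple undirected graph is a \<^term>\<open>pair_graph\<close>: finite vertex set, and a symmetric
  irreflexive arc relation on it, so that an edge is a pair of opposite arcs.
\<close>

definition closed_nbhd :: "'a pair_pre_digraph \<Rightarrow> 'a \<Rightarrow> 'a set" where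
  "closed_nbhd G v = {v} \<union> {u. (v, u) \<in> parcs G}"

text \<open>
  The distance is the least cost of a walk when every arc costs 1; it is \<^term>\<open>\<infinity> :: ereal\<close> when
  there is no walk. So a disconnected graph has diameter \<^term>\<open>\<infinity> :: ereal\<close>.
\<close>

definition graph_dist :: "'a pair_pre_digraph \<Rightarrow> 'a \<Rightarrow> 'a \<Rightarrow> ereal" where
  "graph_dist G u v = wf_digraph.\<mu> (with_proj G) (\<lambda>_. 1) u v"

definition graph_diam :: "'a pair_pre_digraph \<Rightarrow> ereal" where
  "graph_diam G = (SUP u \<in> pverts G. SUP v \<in> pverts G. graph_dist G u v)"

definition limited_packing :: "nat \<Rightarrow> 'a pair_pre_digraph \<Rightarrow> 'a set \<Rightarrow> bool" where
  "limited_packing k G B \<longleftrightarrow>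
     B \<subseteq> pverts G \<and> (\<forall>v \<in> pverts G. card (closed_nbhd G v \<inter> B) \<le> k)"

definition limited_packing_number :: "nat \<Rightarrow> 'a pair_pre_digraph \<Rightarrow> nat" where
  "limited_packing_number k G = Max {card B | B. limited_packing k G B}"

text \<open>The maximum is over a finite nonempty set.\<close>

lemma limited_packing_cards_finite_nonempty:
  assumes "finite (pverts G)"
  shows "finite {card B | B. limited_packing k G B}" "{card B | B. limited_packing k G B} \<noteq> {}"
proof -
  have "{card B | B. limited_packing k G B} \<subseteq> card ` Pow (pverts G)"
    by (auto simp: limited_packing_def)
  then show "finite {card B | B. limited_packing k G B}"
    by (rule finite_subset) (simp add: assms)
  have "limited_packing k G {}"
    by (simp add: limited_packing_def)
  then show "{card B | B. limited_packing k G B} \<noteq> {}"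
    by blast
qed

end

theory Submission
  imports Defs
begin

text \<open>
  Take an independent set \<open>I\<close> of \<open>a\<close> vertices and a clique \<open>W\<close> with, for all \<open>k, l \<in> I\<close>,
  a vertex whose neighbours in \<open>I\<close> are \<open>k\<close> and \<open>l\<close>. The diameter is 2, and \<open>I\<close> is a 2-limited
  packing. A packing that meets \<open>W\<close> has at most 2 elements, because \<open>W\<close> is contained in the closed
  neighbourhood of each of its vertices, and for any two vertices of \<open>I\<close> some vertex of \<open>W\<close> sees
  both of them.
\<close>

context pair_wf_digraph
begin

lemma graph_dist_le_2:
  assumes "u \<in> pverts G" "v \<in> pverts G"
    and "u = v \<or> (u, v) \<in> parcs G \<or> (\<exists>w. (u, w) \<in> parcs G \<and> (w, v) \<in> parcs G)"
  shows "graph_dist G u v \<le> 2"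
proof -
  obtain p where p: "awalk u p v" "length p \<le> 2"
  proof -
    consider "u = v" | "(u, v) \<in> parcs G" | w where "(u, w) \<in> parcs G" "(w, v) \<in> parcs G"
      using assms(3) by blast
    then show thesis
    proof cases
      case 1
      then show thesis using assms by (intro that[of "[]"]) (auto simp: awalk_def)
    next
      case 2
      then show thesis using assms by (intro that[of "[(u, v)]"]) (auto simp: awalk_def)
    next
      case 3
      then show thesis using assms by (intro that[of "[(u, w), (w, v)]"]) (auto simp: awalk_def)
    qed
  qed
  have "graph_dist G u v \<le> awalk_cost (\<lambda>_. 1) p"
    unfolding graph_dist_def by (rule min_cost_le_walk_cost[OF p(1)])
  also have "\<dots> = ereal (length p)"
    by (simp add: awalk_cost_def sum_list_triv)
  also have "\<dots> \<le> 2"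
    using p(2) by simp
  finally show ?thesis .
qed

text \<open>A walk of length 0 joins a vertex to itself and one of length 1 is an arc. The bound
  ranges over all walks, so a pair joined by none, at distance infinity, is covered too.\<close>

lemma graph_dist_ge_2:
  assumes "u \<noteq> v" "(u, v) \<notin> parcs G"
  shows "2 \<le> graph_dist G u v"
  unfolding graph_dist_def \<mu>_def
proof (rule INF_greatest)
  fix p assume "p \<in> {p. awalk u p v}"
  then have p: "awalk u p v" by simp
  have "2 \<le> length p"
  proof (cases p)
    case Nil
    then show ?thesis using p assms by (auto simp: awalk_def)
  next
    case (Cons e q)
    then show ?thesis using p assms by (cases q) (auto simp: awalk_def)
  qed
  then show "2 \<le> ereal (awalk_cost (\<lambda>_. 1) p)"
    by (simp add: awalk_cost_def sum_list_triv)
qed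

lemma graph_diam_eq_2I:
  assumes close: "\<And>u v. u \<in> pverts G \<Longrightarrow> v \<in> pverts G \<Longrightarrow>
      u = v \<or> (u, v) \<in> parcs G \<or> (\<exists>w. (u, w) \<in> parcs G \<and> (w, v) \<in> parcs G)"
    and st: "s \<in> pverts G" "t \<in> pverts G" "s \<noteq> t" "(s, t) \<notin> parcs G"
  shows "graph_diam G = 2"
proof (rule antisym)
  show "graph_diam G \<le> 2"
    unfolding graph_diam_def by (intro SUP_least graph_dist_le_2 close)
  have "2 \<le> graph_dist G s t"
    using st by (intro graph_dist_ge_2)
  then show "2 \<le> graph_diam G"
    unfolding graph_diam_def by (intro SUP_upper2[OF st(1)] SUP_upper2[OF st(2)])
qed

end

text \<open>\<open>ends w\<close> is the set of vertices of \<open>I\<close> that \<open>w\<close>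
  is to see. Since \<open>covers\<close> allows \<open>k = l\<close>, every vertex of
  \<open>I\<close> gets a neighbour in \<open>W\<close>; the inequality in \<open>card_ends\<close>
  leaves room for a clique vertex that sees only one vertex of \<open>I\<close>.\<close>

locale clique_covering_pairs =
  fixes I W :: "'a set" and ends :: "'a \<Rightarrow> 'a set"
  assumes finite_I: "finite I" and finite_W: "finite W" and disjoint: "I \<inter> W = {}"
    and ends_subset: "w \<in> W \<Longrightarrow> ends w \<subseteq> I"
    and card_ends: "w \<in> W \<Longrightarrow> card (ends w) \<le> 2"
    and covers: "k \<in> I \<Longrightarrow> l \<in> I \<Longrightarrow> \<exists>w\<in>W. k \<in> ends w \<and> l \<in> ends w"
    and card_I: "2 \<le> card I"
begin

definition incidence_graph :: "'a pair_pre_digraph" where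
  "incidence_graph = \<lparr> pverts = I \<union> W,
     parcs = {(x, y). x \<noteq> y \<and> (x \<in> W \<and> y \<in> W \<or> x \<in> W \<and> y \<in> ends x \<or> y \<in> W \<and> x \<in> ends y)} \<rparr>"

lemma pverts_incidence_graph [simp]: "pverts incidence_graph = I \<union> W"
  by (simp add: incidence_graph_def)

lemma parcs_incidence_graph [simp]:
  "(x, y) \<in> parcs incidence_graph \<longleftrightarrow>
     x \<noteq> y \<and> (x \<in> W \<and> y \<in> W \<or> x \<in> W \<and> y \<in> ends x \<or> y \<in> W \<and> x \<in> ends y)"
  by (simp add: incidence_graph_def)

lemma pair_graph_incidence_graph: "pair_graph incidence_graph"
proof
  show wf: "fst e \<in> pverts incidence_graph" "snd e \<in> pverts incidence_graph"
    if "e \<in> parcs incidence_graph" for e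
    using that ends_subset by (cases e; auto)+
  show fin: "finite (pverts incidence_graph)"
    by (simp add: finite_I finite_W)
  have "parcs incidence_graph \<subseteq> pverts incidence_graph \<times> pverts incidence_graph"
    using wf by (auto simp: mem_Times_iff simp del: pverts_incidence_graph)
  then show "finite (parcs incidence_graph)"
    by (rule finite_subset) (use fin in blast)
  show "symmetric incidence_graph"
    by (auto simp: symmetric_def intro!: symI)
  show "fst e \<noteq> snd e" if "e \<in> parcs incidence_graph" for e
    using that by (cases e) auto
qed

lemma graph_diam_incidence_graph: "graph_diam incidence_graph = 2"
proof -
  interpret pair_graph incidence_graph by (rule pair_graph_incidence_graph)
  \<comment> \<open>Every arc has an end in \<open>W\<close>, so two distinct vertices of
    \<open>I\<close> are never adjacent.\<close>
  obtain s t where st: "s \<in> I" "t \<in> I" "s \<noteq> t"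
    using card_I by (elim obtain_subset_with_card_n) (auto simp: card_2_iff)
  show ?thesis
  proof (rule graph_diam_eq_2I)
    show "s \<in> pverts incidence_graph" "t \<in> pverts incidence_graph" "s \<noteq> t"
      "(s, t) \<notin> parcs incidence_graph"
      using st disjoint by auto
  next
    fix u v assume "u \<in> pverts incidence_graph" "v \<in> pverts incidence_graph"
    then consider "u \<in> W" "v \<in> W" | "u \<in> I" "v \<in> W" | "u \<in> W" "v \<in> I" | "u \<in> I" "v \<in> I"
      by auto
    then show "u = v \<or> (u, v) \<in> parcs incidence_graph \<or>
        (\<exists>w. (u, w) \<in> parcs incidence_graph \<and> (w, v) \<in> parcs incidence_graph)"
    proof cases
      case 1
      then show ?thesis by auto
    next
      case 2
      \<comment> \<open>Some clique vertex sees \<open>u\<close>; it either is \<open>v\<close> or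
        is adjacent to \<open>v\<close>.\<close>
      then show ?thesis using covers[of u u] disjoint by (auto 4 3)
    next
      case 3
      then show ?thesis using covers[of v v] disjoint by (auto 4 3)
    next
      case 4
      then show ?thesis using covers[of u v] disjoint by (auto 4 3)
    qed
  qed
qed

lemma closed_nbhd_W: "w \<in> W \<Longrightarrow> closed_nbhd incidence_graph w = W \<union> ends w"
  using disjoint ends_subset by (auto simp: closed_nbhd_def)

lemma closed_nbhd_I: "i \<in> I \<Longrightarrow> closed_nbhd incidence_graph i \<inter> I = {i}"
  using disjoint by (auto simp: closed_nbhd_def)

lemma limited_packing_I: "limited_packing 2 incidence_graph I"
  unfolding limited_packing_def
proof (intro conjI ballI)
  fix v assume "v \<in> pverts incidence_graph"
  then consider "v \<in> I" | "v \<in> W" by auto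
  then show "card (closed_nbhd incidence_graph v \<inter> I) \<le> 2"
  proof cases
    case 1
    then show ?thesis by (simp add: closed_nbhd_I)
  next
    case 2
    then have "closed_nbhd incidence_graph v \<inter> I = ends v"
      using disjoint ends_subset by (auto simp: closed_nbhd_W)
    then show ?thesis using card_ends[OF 2] by simp
  qed
qed simp

lemma card_limited_packing_le:
  assumes B: "limited_packing 2 incidence_graph B"
  shows "card B \<le> card I"
proof (cases "B \<inter> W = {}")
  case True
  then have "B \<subseteq> I"
    using B by (auto simp: limited_packing_def)
  then show ?thesis by (rule card_mono[OF finite_I])
next
  case False
  have sub: "B \<subseteq> I \<union> W" and fin: "finite B"
    using B finite_I finite_W by (auto simp: limited_packing_def intro: finite_subset)
  have le: "card ((W \<union> ends w) \<inter> B) \<le> 2" if "w \<in> W" for w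
    using B that unfolding closed_nbhd_W[OF that, symmetric] by (simp add: limited_packing_def)
  have "card B \<le> 2"
  proof (rule ccontr)
    assume "\<not> card B \<le> 2"
    obtain x where x: "x \<in> B" "x \<in> W" using False by blast
    obtain y z where yz: "y \<in> B" "z \<in> B" "x \<noteq> y" "x \<noteq> z" "y \<noteq> z"
    proof -
      have "2 \<le> card (B - {x})"
        using \<open>\<not> card B \<le> 2\<close> x fin by simp
      then obtain T where "T \<subseteq> B - {x}" "card T = 2"
        by (elim obtain_subset_with_card_n)
      then show thesis
        using that by (auto simp: card_2_iff)
    qed
    \<comment> \<open>The choice depends on where \<open>y\<close> and \<open>z\<close> lie: with
      both in \<open>I\<close>, a clique vertex that sees both; with one in \<open>I\<close>, a
      clique vertex that sees it; with none, \<open>x\<close> itself. In each case \<open>x\<close>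
      is in the closed neighbourhood as well, being in \<open>W\<close>.\<close>
    obtain w where "w \<in> W" "y \<in> W \<union> ends w" "z \<in> W \<union> ends w"
    proof -
      have "y \<in> I \<union> W" "z \<in> I \<union> W" using yz sub by auto
      then show thesis
        using that covers[of y z] covers[of y y] covers[of z z] x(2) by blast
    qed
    then have "{x, y, z} \<subseteq> (W \<union> ends w) \<inter> B"
      using x yz by auto
    then have "card {x, y, z} \<le> 2"
      using le[OF \<open>w \<in> W\<close>] fin by (meson card_mono finite_Int le_trans)
    then show False using yz by simp
  qed
  \<comment> \<open>Here \<open>card I\<close> must be at least 2: a packing that meets
    \<open>W\<close> may have two elements.\<close>
  then show ?thesis using card_I by simp
qed

lemma limited_packing_number_incidence_graph: "limited_packing_number 2 incidence_graph = card I"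
  unfolding limited_packing_number_def
proof (rule Max_eqI)
  show "finite {card B |B. limited_packing 2 incidence_graph B}"
    by (rule limited_packing_cards_finite_nonempty) (simp add: finite_I finite_W)
qed (use card_limited_packing_le limited_packing_I in auto)

end

theorem theorem4p4:
  fixes a :: nat
  assumes "a \<ge> 2"
  shows "\<exists>G :: nat pair_pre_digraph.
           pair_graph G \<and> graph_diam G = 2 \<and> limited_packing_number 2 G = a"
proof -
  text \<open>The clique vertex \<open>(k + 1) * a + l\<close> sees \<open>k\<close> and \<open>l\<close>.\<close>
  define ends :: "nat \<Rightarrow> nat set" where "ends w = {w div a - 1, w mod a}" for w
  \<comment> \<open>Division by \<open>a\<close> gives quotient 0 on \<open>I\<close> and quotients
    1 to \<open>a\<close> on \<open>W\<close>, which explains the shift by one in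
    \<open>ends\<close>. \<open>W\<close> has one vertex for each ordered pair, the diagonal
    included.\<close>
  interpret clique_covering_pairs "{..<a}" "{a..<(a + 1) * a}" ends
  proof
    fix w assume "w \<in> {a..<(a + 1) * a}"
    then have "w div a < a + 1" by (simp add: less_mult_imp_div_less)
    then show "ends w \<subseteq> {..<a}" using assms by (auto simp: ends_def)
    show "card (ends w) \<le> 2" by (simp add: ends_def card_insert_if)
  next
    fix k l assume kl: "k \<in> {..<a}" "l \<in> {..<a}"
    \<comment> \<open>The upper end of \<open>W\<close> is respected because \<open>l < a\<close>
      and \<open>k + 1 \<le> a\<close>.\<close>
    have "(k + 1) * a + l < (k + 2) * a" using kl by simp
    also have "\<dots> \<le> (a + 1) * a" using kl by (intro mult_right_mono) auto
    finally have "(k + 1) * a + l \<in> {a..<(a + 1) * a}" by simp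
    moreover have "((k + 1) * a + l) div a = k + 1" "((k + 1) * a + l) mod a = l"
      using kl by (simp_all add: div_mult_self3 mod_mult_self3 del: mult_Suc)
    ultimately show "\<exists>w\<in>{a..<(a + 1) * a}. k \<in> ends w \<and> l \<in> ends w"
      unfolding ends_def by (intro bexI[of _ "(k + 1) * a + l"]) auto
  qed (use assms in auto)
  show ?thesis
    using pair_graph_incidence_graph graph_diam_incidence_graph
      limited_packing_number_incidence_graph by auto
qed

end
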